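(* Let $f$ be an entire function of genus one (in the sense of the context) such that $f(0)\neq 0$. If $f$ is in the first order Laguerre-Pólya class ($1$-LP), then its aperture $\kappa$ satisfies $$\kappa \geq \frac{\sqrt{3}}{\pi}.$$
   Context: An entire function of genus one with $f(0)\ne 0$ means a function of the form $$f(z) = e^{d_1+d_2z}\prod_{i=1}^{\infty} \left( 1 - \frac{z}{\lambda_i} \right) e^{z/\lambda_i},$$ where $d_1,d_2\in\mathbb{C}$, the $\lambda_i$ are nonzero complex numbers (the zeros of $f$ listed with multiplicity), and $\sum_i \frac{1}{|\lambda_i|^2} <\infty$. For $x\in\mathbb{R}\setminus\{\lambda_i\}$ and $n\ge 1$ put $a_n(x)=\sum_{i}\frac{1}{(\lambda_i-x)^{n+1}}$ (these are the coefficients of $(z-x)^n$ in the power series at $x$ of $-f'/f$). For $N\in\mathbb{N}$, let $A_N(x)$ be the $N\times N$ matrix with $(j,k)$ entry $a_{j+k-1}(x)$, $1\le j,k\le N$. The function $f$ is in the $N$-th order Laguerre-Pólya class ($N$-LP) if $d_2\in\mathbb{R}$ and $A_N(x)$ is positive semidefinite (in particular Hermitian) for all $x\in\mathbb{R}\setminus\{\lambda_i\}$. For $N=1$ the matrix condition says that $a_1(x)$ is real and $a_1(x)\geq 0$ for all such $x$. The spacing constant $c$ of $f$ is $c=0$ if $f$ has a repeated zero, and, if all zeros are simple, $$c=\inf_{i \ne j} \left\{ \left| \Re(\lambda_i-\lambda_j) \right|: \lambda_i \ne \bar{\lambda}_j \right\}.$$ The height of $f$ is $b= \inf_i \{| \Im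 (\lambda_i)| : \Im (\lambda_i) \neq 0\}$, with $b=\infty$ if there are no non-real zeros. The aperture of $f$ is $\kappa = b/c$ if $c\neq 0$, and $\kappa=\infty$ if $c=0$ (also $\kappa=\infty$ if $b=\infty$). *)

theory Defs
  imports
    "HOL-Complex_Analysis.Complex_Analysis"
    "Jordan_Normal_Form.Schur_Decomposition"
begin

(* A zero enters the sequence lam once for each unit of its multiplicity, so a repeated zero
   of f is a repetition in lam. Indices start at 0. *)
definition genus_one ::
    "(complex \<Rightarrow> complex) \<Rightarrow> complex \<Rightarrow> complex \<Rightarrow> (nat \<Rightarrow> complex) \<Rightarrow> bool" where
  "genus_one f d1 d2 lam \<longleftrightarrow>
     (\<forall>i. lam i \<noteq> 0) \<and>
     summable (\<lambda>i. 1 / (cmod (lam i))\<^sup>2) \<and>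
     (\<forall>z. f z = exp (d1 + d2 * z) * (\<Prod>i. (1 - z / lam i) * exp (z / lam i)))"

definition log_deriv_coeff :: "(nat \<Rightarrow> complex) \<Rightarrow> nat \<Rightarrow> real \<Rightarrow> complex" where
  "log_deriv_coeff lam n x = (\<Sum>i. 1 / (lam i - of_real x) ^ (n + 1))"

(* Matrix indices start at 0, so j + k - 1 becomes j + k + 1. *)
definition LP_matrix :: "(nat \<Rightarrow> complex) \<Rightarrow> nat \<Rightarrow> real \<Rightarrow> complex mat" where
  "LP_matrix lam N x = mat N N (\<lambda>(j, k). log_deriv_coeff lam (j + k + 1) x)"

definition pos_semidef :: "complex mat \<Rightarrow> bool" where
  "pos_semidef A \<longleftrightarrow> square_mat A \<and> mat_adjoint A = A \<and>
     (\<forall>v \<in> carrier_vec (dim_row A). (A *\<^sub>v v) \<bullet>c v \<in> \<real>\<^sub>\<ge>\<^sub>0)"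

definition laguerre_polya :: "nat \<Rightarrow> complex \<Rightarrow> (nat \<Rightarrow> complex) \<Rightarrow> bool" where
  "laguerre_polya N d2 lam \<longleftrightarrow>
     d2 \<in> \<real> \<and> (\<forall>x::real. of_real x \<notin> range lam \<longrightarrow> pos_semidef (LP_matrix lam N x))"

(* For an infinite sequence of distinct zeros the set is nonempty, so the real infimum is the
   intended one. *)
definition spacing_constant :: "(nat \<Rightarrow> complex) \<Rightarrow> real" where
  "spacing_constant lam =
     (if inj lam then Inf {\<bar>Re (lam i - lam j)\<bar> | i j. i \<noteq> j \<and> lam i \<noteq> cnj (lam j)} else 0)"

(* The infimum of the empty set is \<infinity>. *)
definition height :: "(nat \<Rightarrow> complex) \<Rightarrow> ereal" where
  "height lam = (INF i \<in> {i. Im (lam i) \<noteq> 0}. ereal \<bar>Im (lam i)\<bar>)"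

definition aperture :: "(nat \<Rightarrow> complex) \<Rightarrow> ereal" where
  "aperture lam =
     (if spacing_constant lam = 0 \<or> height lam = \<infinity> then \<infinity>
      else height lam / ereal (spacing_constant lam))"

end

theory Submission
  imports Defs
begin

text \<open>Suppose \<open>c > 0\<close> and let \<open>\<lambda>\<close> be a non-real zero with imaginary part \<open>\<beta>\<close>. Reality of
  \<open>a\<^sub>1\<close> on the line forces, by analytic continuation, the zeros to be symmetric under conjugation,
  so at \<open>x = Re \<lambda>\<close> the pair of \<open>\<lambda>\<close> and its conjugate contributes \<open>- 2 / \<beta>\<^sup>2\<close> to \<open>a\<^sub>1(x)\<close>. Any
  other zero contributes at most \<open>1 / u\<^sup>2\<close> with \<open>u\<close> its horizontal distance from \<open>x\<close>; each value
  of \<open>Re\<close> is taken at most twice and distinct values are \<open>c\<close>-separated, so these contributions add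
  up to at most \<open>4 / c\<^sup>2\<close> times \<open>\<Sum>k\<ge>1. 1 / k\<^sup>2 = \<pi>\<^sup>2 / 6\<close>. Now \<open>a\<^sub>1(x) \<ge> 0\<close> gives
  \<open>\<beta>\<^sup>2 \<ge> 3 c\<^sup>2 / \<pi>\<^sup>2\<close>.\<close>

section \<open>Growth of the zeros and convergence of the shifted series\<close>

lemma summable_inverse_square_imp_at_infinity:
  fixes lam :: "nat \<Rightarrow> complex"
  assumes "\<And>i. lam i \<noteq> 0" and "summable (\<lambda>i. 1 / (cmod (lam i))\<^sup>2)"
  shows "eventually (\<lambda>i. cmod (lam i) > R) sequentially"
proof -
  \<comment> \<open>The absolute value covers negative \<open>R\<close>, and adding 1 keeps the
    denominator nonzero at \<open>R = 0\<close>.\<close>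
  define e where "e = 1 / (\<bar>R\<bar> + 1)\<^sup>2"
  have "(\<lambda>i. 1 / (cmod (lam i))\<^sup>2) \<longlonglongrightarrow> 0" 
    using assms(2) by (rule summable_LIMSEQ_zero)
  moreover have "e > 0" by (simp add: e_def add_nonneg_pos)
  ultimately have "eventually (\<lambda>i. 1 / (cmod (lam i))\<^sup>2 < e) sequentially"
    by (rule order_tendstoD)
  thus ?thesis
  proof eventually_elim
    case (elim i)
    have "(cmod (lam i))\<^sup>2 > 0" using assms(1)[of i] by simp
    hence "(\<bar>R\<bar> + 1)\<^sup>2 < (cmod (lam i))\<^sup>2"
      using elim by (simp add: e_def field_simps add_nonneg_pos)
    hence "\<bar>R\<bar> + 1 < cmod (lam i)" by (rule power_less_imp_less_base) simp
    thus ?case by simp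
  qed
qed

text \<open>A ball meets \<open>P\<close> in finitely many points, so \<open>P\<close> has no limit
  point. Arbitrary subsets are allowed because a pole set with one zero removed is needed
  later.\<close>

lemma closed_subset_range_at_infinity:
  fixes lam :: "nat \<Rightarrow> complex"
  assumes "\<And>R. eventually (\<lambda>i. cmod (lam i) > R) sequentially" and "P \<subseteq> range lam"
  shows "closed P"
proof -
  have fin: "finite (P \<inter> ball x 1)" for x
  proof -
    obtain n where n: "\<And>i. i \<ge> n \<Longrightarrow> cmod (lam i) > cmod x + 1"
      using assms(1)[of "cmod x + 1"] by (auto simp: eventually_sequentially)
    have "P \<inter> ball x 1 \<subseteq> lam ` {..<n}"
    proof
      fix y assume y: "y \<in> P \<inter> ball x 1"
      then obtain i where i: "y = lam i" using assms(2) by auto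
      have "cmod y \<le> cmod x + dist x y"
        using norm_triangle_ineq2[of y x] by (simp add: dist_norm norm_minus_commute)
      hence "\<not> i \<ge> n" using n[of i] i y by auto
      thus "y \<in> lam ` {..<n}" using i by auto
    qed
    thus ?thesis by (rule finite_subset) simp
  qed
  have "\<not> x islimpt P" for x
    using fin[of x] by (force simp: islimpt_eq_infinite_ball intro: exI[of _ 1])
  thus ?thesis by (simp add: closed_limpt)
qed

lemma norm_inverse_square_diff_le:
  fixes w z :: complex
  assumes "cmod w > 2 * cmod z" 
  shows "cmod (1 / (w - z)\<^sup>2) \<le> 4 * (1 / (cmod w)\<^sup>2)"
proof -
  have "cmod w / 2 \<le> cmod (w - z)" using norm_triangle_ineq2[of w z] assms by simp
  hence "(cmod w / 2)\<^sup>2 \<le> (cmod (w - z))\<^sup>2" by (intro power_mono) auto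
  moreover have "cmod w > 0" using assms norm_ge_zero[of z] by linarith
  ultimately have "1 / (cmod (w - z))\<^sup>2 \<le> 1 / (cmod w / 2)\<^sup>2"
    by (intro divide_left_mono) (auto simp: zero_less_mult_iff)
  thus ?thesis by (simp add: norm_divide norm_power power_divide)
qed

text \<open>The comparison is only eventual, so finitely many small zeros, or a zero equal to
  \<open>z\<close>, do no harm.\<close>

lemma summable_inverse_square_diff:
  fixes lam :: "nat \<Rightarrow> complex"
  assumes "\<And>i. lam i \<noteq> 0" and "summable (\<lambda>i. 1 / (cmod (lam i))\<^sup>2)"
  shows "summable (\<lambda>i. 1 / (lam i - z)\<^sup>2)"
proof (rule summable_comparison_test_ev)
  show "eventually (\<lambda>i. norm (1 / (lam i - z)\<^sup>2) \<le> 4 * (1 / (cmod (lam i))\<^sup>2)) sequentially"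
    using summable_inverse_square_imp_at_infinity[OF assms, of "2 * cmod z"]
    by eventually_elim (rule norm_inverse_square_diff_le)
  show "summable (\<lambda>i. 4 * (1 / (cmod (lam i))\<^sup>2))" by (intro summable_mult assms)
qed

section \<open>Conjugation symmetry of the zeros\<close>

text \<open>If the conjugate were missing, the series minus its reflection would vanish at real
  points near 0 and hence identically, yet it has a double pole at \<open>lam m\<close>.\<close>

lemma cnj_in_range:
  fixes lam :: "nat \<Rightarrow> complex"
  assumes nz: "\<And>i. lam i \<noteq> 0" and sm: "summable (\<lambda>i. 1 / (cmod (lam i))\<^sup>2)"
    and inj: "inj lam"
    and real: "\<And>x::real. of_real x \<notin> range lam \<Longrightarrow> (\<Sum>i. 1 / (lam i - of_real x)\<^sup>2) \<in> \<real>"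
  shows "cnj (lam m) \<in> range lam"
proof (rule ccontr)
  assume no: "cnj (lam m) \<notin> range lam"
  define lam' where "lam' = (\<lambda>i. cnj (lam i))"
  define P where "P = range lam - {lam m} \<union> range lam'"
  \<comment> \<open>Dropping the singular term of index \<open>m\<close> makes the sum regular at
    \<open>lam m\<close>; injectivity ensures that no other term has a pole there.\<close>
  define T where "T = (\<lambda>i z. (if i = m then 0 else 1 / (lam i - z)\<^sup>2) - 1 / (lam' i - z)\<^sup>2)"
  have nz': "\<And>i. lam' i \<noteq> 0" and sm': "summable (\<lambda>i. 1 / (cmod (lam' i))\<^sup>2)"
    using nz sm by (auto simp: lam'_def)
  note inf = summable_inverse_square_imp_at_infinity[OF nz sm]
    and inf' = summable_inverse_square_imp_at_infinity[OF nz' sm']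
  have "closed P" unfolding P_def
    by (intro closed_Un closed_subset_range_at_infinity[OF inf] 
        closed_subset_range_at_infinity[OF inf']) auto
  hence op: "open (-P)" by auto
  have "countable P" by (auto simp: P_def)
  \<comment> \<open>Removing countably many points leaves the plane path connected.\<close>
  hence conn: "connected (-P)"
    by (intro path_connected_imp_connected path_connected_complement_countable) auto
  have mP: "lam m \<in> -P"
    using no by (auto simp: P_def lam'_def)
  have "0 \<notin> range lam" "0 \<notin> range lam'" using nz nz' by (metis rangeE)+
  hence "0 \<in> -P" by (simp add: P_def)
  have differ: "T i field_differentiable (at z)" if "z \<in> -P" for i z
  proof -
    have "lam' i - z \<noteq> 0" "i \<noteq> m \<Longrightarrow> lam i - z \<noteq> 0"
      using that inj by (auto simp: P_def inj_eq)
    thus ?thesis unfolding T_def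
      by (cases "i = m") (auto intro!: derivative_intros)
  qed
  have bound: "\<exists>d h. 0 < d \<and> summable h \<and> range h \<subseteq> \<real>\<^sub>\<ge>\<^sub>0 \<and>
      (\<forall>\<^sub>F n in sequentially. \<forall>y\<in>ball x d \<inter> -P. cmod (T n y) \<le> cmod (h n))" for x
  proof (intro exI conjI)
    \<comment> \<open>The 8 is 4 + 4, one 4 for each half of \<open>T\<close>.\<close>
    let ?h = "\<lambda>i. of_real (8 * (1 / (cmod (lam i))\<^sup>2)) :: complex"
    show "(0::real) < 1" by simp
    show "summable ?h" by (intro summable_of_real summable_mult sm)
    show "range ?h \<subseteq> \<real>\<^sub>\<ge>\<^sub>0" by (auto simp del: of_real_mult)
    show "\<forall>\<^sub>F n in sequentially. \<forall>y\<in>ball x 1 \<inter> -P. cmod (T n y) \<le> cmod (?h n)"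
      using inf[of "2 * (cmod x + 1)"]
    proof eventually_elim
      case (elim i)
      show ?case
      proof
        fix y assume "y \<in> ball x 1 \<inter> -P"
        hence "cmod y \<le> cmod x + 1"
          using norm_triangle_ineq2[of y x] by (simp add: dist_norm norm_minus_commute)
        hence y: "cmod (lam i) > 2 * cmod y" "cmod (lam' i) > 2 * cmod y"
          using elim by (simp_all add: lam'_def)
        have "cmod (T i y) \<le> cmod (if i = m then 0 else 1 / (lam i - y)\<^sup>2)
            + cmod (1 / (lam' i - y)\<^sup>2)"
          unfolding T_def by (rule norm_triangle_ineq4)
        also have "\<dots> \<le> 4 * (1 / (cmod (lam i))\<^sup>2) + 4 * (1 / (cmod (lam' i))\<^sup>2)"
          using norm_inverse_square_diff_le[OF y(1)] norm_inverse_square_diff_le[OF y(2)]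
          by (intro add_mono) auto
        also have "\<dots> = cmod (?h i)"
          unfolding norm_of_real by (simp add: lam'_def)
        finally show "cmod (T i y) \<le> cmod (?h i)" .
      qed
    qed
  qed
  obtain G where "\<forall>z\<in>-P. (\<lambda>i. T i z) sums G z \<and> G field_differentiable (at z)"
    by (rule series_differentiable_comparison_complex[OF op differ bound])
  hence G: "(\<lambda>i. T i z) sums G z" "G field_differentiable (at z)" if "z \<in> -P" for z
    using that by simp_all
  \<comment> \<open>The factor cancels the pole at \<open>lam m\<close>, so that the identity theorem applies on a set
    containing that point.\<close>
  define F where "F = (\<lambda>z. 1 + (lam m - z)\<^sup>2 * G z)"
  have "G holomorphic_on (-P)"
    using G(2) by (auto simp: holomorphic_on_def intro: field_differentiable_at_within)
  hence holo: "F holomorphic_on (-P)"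
    unfolding F_def by (intro holomorphic_intros)
  \<comment> \<open>At a real point, conjugating the terms conjugates the sum, which is real. The
    two full series cancel, and only the dropped term is left.\<close>
  have real0: "F z = 0" if "z \<in> \<real> \<inter> -P - {lam m}" for z
  proof -
    have "z \<in> \<real>" using that by blast
    then obtain x :: real where x: "z = of_real x" by (rule Reals_cases)
    have "z \<notin> range lam" using that by (auto simp: P_def)
    hence re: "(\<Sum>i. 1 / (lam i - z)\<^sup>2) \<in> \<real>" using real x by auto
    let ?a = "\<Sum>i. 1 / (lam i - z)\<^sup>2"
    have a: "(\<lambda>i. 1 / (lam i - z)\<^sup>2) sums ?a"
      using summable_inverse_square_diff[OF nz sm] by (rule summable_sums)
    have "(\<lambda>i. cnj (1 / (lam i - z)\<^sup>2)) sums cnj ?a"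
      using a by (simp only: sums_cnj)
    hence a': "(\<lambda>i. 1 / (lam' i - z)\<^sup>2) sums ?a"
      using re by (simp add: lam'_def x Reals_cnj_iff)
    have "(\<lambda>i. if i = m then 1 / (lam m - z)\<^sup>2 else 0) sums (1 / (lam m - z)\<^sup>2)"
      by (rule sums_single)
    from sums_diff[OF sums_diff[OF a this] a']
    have "(\<lambda>i. T i z) sums (?a - 1 / (lam m - z)\<^sup>2 - ?a)"
      by (rule sums_cong[THEN iffD1, rotated]) (auto simp: T_def)
    moreover have "(\<lambda>i. T i z) sums G z" using that by (intro G(1)) auto
    ultimately have "G z = - (1 / (lam m - z)\<^sup>2)" by (simp add: sums_iff)
    moreover have "lam m - z \<noteq> 0" using that by auto
    ultimately show ?thesis by (simp add: F_def)
  qed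
  have "F (lam m) = 0"
  proof (rule analytic_continuation[OF holo op conn])
    show "\<real> \<inter> -P - {lam m} \<subseteq> -P" by auto
    \<comment> \<open>The identity theorem is anchored at 0, which is neither a zero nor the
      conjugate of one.\<close>
    show "0 islimpt \<real> \<inter> -P - {lam m}"
    proof -
      have "open (-P - {lam m})" using op by (intro open_delete)
      moreover have "0 \<in> -P - {lam m}" using \<open>0 \<in> -P\<close> nz[of m] by auto
      ultimately obtain e where e: "e > 0" "ball 0 e \<subseteq> -P - {lam m}"
        by (meson open_contains_ball)
      show ?thesis unfolding islimpt_approachable
      proof safe
        fix d :: real assume d: "d > 0"
        define y where "y = complex_of_real (min d e / 2)"
        have n: "cmod y = min d e / 2" using d e by (simp only: y_def norm_of_real)
        have "y \<in> ball 0 e" using n d e by auto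
        with e(2) have "y \<in> -P - {lam m}" by (rule subsetD)
        moreover have "y \<in> \<real>" unfolding y_def by (rule Reals_of_real)
        ultimately have "y \<in> \<real> \<inter> -P - {lam m}" by simp
        moreover have "y \<noteq> 0" using n d e by fastforce
        moreover have "dist y 0 < d" using n d e by auto
        ultimately show "\<exists>y\<in>\<real> \<inter> -P - {lam m}. y \<noteq> 0 \<and> dist y 0 < d"
          by (intro bexI[of _ y] conjI)
      qed
    qed
  qed (fact \<open>0 \<in> -P\<close> mP real0)+
  \<comment> \<open>The factor \<open>(lam m - z)\<^sup>2\<close> vanishes at \<open>lam m\<close>,
    so \<open>F\<close> equals 1 there.\<close>
  thus False by (simp add: F_def)
qed

section \<open>Bounds for the contribution of the other zeros\<close>

text \<open>Sort the zeros into bins of width \<open>c\<close> by distance from \<open>x\<close>.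
  Each bin holds at most four, and the Basel sum gives
  \<open>4 / c\<^sup>2 * (pi\<^sup>2 / 6)\<close>.\<close>

lemma sum_inverse_squares_separated_le:
  fixes lam :: "nat \<Rightarrow> complex"
  assumes c: "c > 0" and inj: "inj lam"
    and sep: "\<And>i j. i \<noteq> j \<Longrightarrow> lam i \<noteq> cnj (lam j) \<Longrightarrow> c \<le> \<bar>Re (lam i) - Re (lam j)\<bar>"
    and I: "finite I" "\<And>i. i \<in> I \<Longrightarrow> c \<le> \<bar>Re (lam i) - x\<bar>"
  shows "(\<Sum>i\<in>I. 1 / (Re (lam i) - x)\<^sup>2) \<le> 2 * pi\<^sup>2 / (3 * c\<^sup>2)"
proof -
  define u where "u = (\<lambda>i. Re (lam i) - x)"
  \<comment> \<open>The shift by 1 numbers the bins from 0, matching \<open>Suc n\<close> in the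
    Basel series.\<close>
  define k where "k = (\<lambda>i. nat \<lfloor>\<bar>u i\<bar> / c\<rfloor> - 1)"
  have k: "real (Suc (k i)) \<le> \<bar>u i\<bar> / c" "\<bar>u i\<bar> / c < real (Suc (k i)) + 1" if "i \<in> I" for i
  proof -
    have "1 \<le> \<bar>u i\<bar> / c" using I(2)[OF that] c by (simp add: u_def)
    hence "\<lfloor>\<bar>u i\<bar> / c\<rfloor> \<ge> 1" by linarith
    hence "real (Suc (k i)) = of_int \<lfloor>\<bar>u i\<bar> / c\<rfloor>" by (simp add: k_def)
    thus "real (Suc (k i)) \<le> \<bar>u i\<bar> / c" "\<bar>u i\<bar> / c < real (Suc (k i)) + 1" by linarith+
  qed
  \<comment> \<open>Side of \<open>x\<close>, half-plane, bin. Real zeros share a class with the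
    lower half-plane; distinct zeros in one class are never conjugate, so \<open>sep\<close> applies
    to them.\<close>
  define h where "h = (\<lambda>i. (u i > 0, Im (lam i) > 0, k i))"
  have "inj_on h I"
  proof (rule inj_onI, rule ccontr)
    fix i j assume ij: "i \<in> I" "j \<in> I" "h i = h j" "i \<noteq> j"
    have "lam i \<noteq> lam j" using ij(4) inj by (auto dest: injD)
    moreover have "Im (lam i) > 0 \<longleftrightarrow> Im (lam j) > 0" using ij(3) by (auto simp: h_def)
    ultimately have "lam i \<noteq> cnj (lam j)" by (auto simp: complex_eq_iff)
    hence s: "c \<le> \<bar>u i - u j\<bar>" using sep[OF ij(4)] by (simp add: u_def)
    have "u i > 0 \<longleftrightarrow> u j > 0" and kk: "k i = k j" using ij(3) by (auto simp: h_def)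
    hence "\<bar>u i - u j\<bar> = \<bar>\<bar>u i\<bar> - \<bar>u j\<bar>\<bar>" by auto
    hence "1 \<le> \<bar>\<bar>u i\<bar> / c - \<bar>u j\<bar> / c\<bar>"
      using s c by (simp add: diff_divide_distrib[symmetric] abs_divide)
    \<comment> \<open>Both quotients lie in one half-open interval of length 1.\<close>
    thus False using k[OF ij(1)] k[OF ij(2)] kk by auto
  qed
  \<comment> \<open>Inserting 0 keeps \<open>Max\<close> meaningful for empty
    \<open>I\<close>.\<close>
  define K where "K = Suc (Max (insert 0 (k ` I)))"
  have K: "k i < K" if "i \<in> I" for i
    unfolding K_def using that I(1) by (simp add: less_Suc_eq_le)
  have "(\<Sum>i\<in>I. 1 / (u i)\<^sup>2) \<le> (\<Sum>i\<in>I. 1 / c\<^sup>2 * (1 / (real (Suc (k i)))\<^sup>2))"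
  proof (rule sum_mono)
    fix i assume i: "i \<in> I"
    have "c * real (Suc (k i)) \<le> \<bar>u i\<bar>" using k(1)[OF i] c by (simp add: field_simps)
    hence "(c * real (Suc (k i)))\<^sup>2 \<le> \<bar>u i\<bar>\<^sup>2" by (rule power_mono) (use c in simp)
    hence le: "(c * real (Suc (k i)))\<^sup>2 \<le> (u i)\<^sup>2" by simp
    moreover have pos: "(c * real (Suc (k i)))\<^sup>2 > 0" using c by simp
    ultimately have "1 / (u i)\<^sup>2 \<le> 1 / (c * real (Suc (k i)))\<^sup>2"
      by (intro divide_left_mono) (auto intro!: mult_pos_pos)
    thus "1 / (u i)\<^sup>2 \<le> 1 / c\<^sup>2 * (1 / (real (Suc (k i)))\<^sup>2)" 
      by (simp add: power_mult_distrib del: of_nat_Suc)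
  qed
  also have "\<dots> = (\<Sum>(p, q, n)\<in>h ` I. 1 / c\<^sup>2 * (1 / (real (Suc n))\<^sup>2))"
    using \<open>inj_on h I\<close> by (subst sum.reindex) (auto simp: h_def)
  also have "\<dots> \<le> (\<Sum>(p, q, n)\<in>(UNIV :: bool set) \<times> (UNIV :: bool set) \<times> {..<K}. 1 / c\<^sup>2 * (1 / (real (Suc n))\<^sup>2))"
    by (rule sum_mono2) (auto simp: h_def K)
  also have "\<dots> = 4 / c\<^sup>2 * (\<Sum>n<K. 1 / (real (Suc n))\<^sup>2)"
    by (simp add: sum.cartesian_product[symmetric] sum_distrib_left)
  also have "\<dots> \<le> 4 / c\<^sup>2 * (pi\<^sup>2 / 6)"
  proof (rule mult_left_mono)
    have s: "(\<lambda>n. 1 / (real (Suc n))\<^sup>2) sums (pi\<^sup>2 / 6)"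
      using inverse_squares_sums by simp
    show "(\<Sum>n<K. 1 / (real (Suc n))\<^sup>2) \<le> pi\<^sup>2 / 6"
      unfolding sums_unique[OF s] by (rule sum_le_suminf) (use s in \<open>auto simp: sums_iff\<close>)
  qed simp
  finally show ?thesis by (simp add: u_def)
qed

lemma Re_inverse_square_le:
  assumes "Re w \<noteq> 0"
  shows "Re (1 / w\<^sup>2) \<le> 1 / (Re w)\<^sup>2"
proof -
  have "Re (1 / w\<^sup>2) \<le> cmod (1 / w\<^sup>2)" by (rule complex_Re_le_cmod)
  also have "\<dots> = 1 / (cmod w)\<^sup>2" by (simp add: norm_divide norm_power)
  also have "\<dots> \<le> 1 / (Re w)\<^sup>2"
    using assms by (intro divide_left_mono) (auto simp: cmod_power2 sum_power2_gt_zero_iff)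
  finally show ?thesis .
qed

section \<open>The lower bound for the imaginary parts\<close>

text \<open>The quadratic form of a 1 by 1 matrix at the vector 1 is its only entry.\<close>

lemma pos_semidef_LP_matrix_1:
  assumes "pos_semidef (LP_matrix lam 1 x)"
  shows "(\<Sum>i. 1 / (lam i - of_real x)\<^sup>2) \<in> \<real>\<^sub>\<ge>\<^sub>0"
proof -
  define v :: "complex vec" where "v = vec 1 (\<lambda>_. 1)"
  have "(LP_matrix lam 1 x *\<^sub>v v) \<bullet>c v \<in> \<real>\<^sub>\<ge>\<^sub>0"
    using assms by (auto simp: pos_semidef_def LP_matrix_def v_def)
  also have "(LP_matrix lam 1 x *\<^sub>v v) \<bullet>c v = log_deriv_coeff lam 1 x"
    by (simp add: LP_matrix_def v_def scalar_prod_def)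
  finally show ?thesis by (simp add: log_deriv_coeff_def power2_eq_square)
qed

lemma abs_Im_ge_of_separated:
  fixes lam :: "nat \<Rightarrow> complex"
  assumes nz: "\<And>i. lam i \<noteq> 0" and sm: "summable (\<lambda>i. 1 / (cmod (lam i))\<^sup>2)"
    and nonneg: "\<And>x::real. of_real x \<notin> range lam \<Longrightarrow> (\<Sum>i. 1 / (lam i - of_real x)\<^sup>2) \<in> \<real>\<^sub>\<ge>\<^sub>0"
    and c: "c > 0" and inj: "inj lam"
    and sep: "\<And>i j. i \<noteq> j \<Longrightarrow> lam i \<noteq> cnj (lam j) \<Longrightarrow> c \<le> \<bar>Re (lam i) - Re (lam j)\<bar>"
    and m: "Im (lam m) \<noteq> 0"
  shows "sqrt 3 / pi * c \<le> \<bar>Im (lam m)\<bar>"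
proof -
  obtain m' where m': "lam m' = cnj (lam m)"
    using cnj_in_range[OF nz sm inj, of m] nonneg nonneg_Reals_subset_Reals 
    by (metis imageE subsetD)
  have "m' \<noteq> m" using m' m by (auto simp: complex_eq_iff)
  define x where "x = Re (lam m)"
  define \<beta> where "\<beta> = Im (lam m)"
  have far: "c \<le> \<bar>Re (lam i) - x\<bar>" if "i \<noteq> m" "i \<noteq> m'" for i
  proof -
    have "lam i \<noteq> cnj (lam m)" using that(2) m' inj by (metis injD)
    thus ?thesis using sep[of i m] that(1) by (simp add: x_def)
  qed
  \<comment> \<open>A real zero at \<open>x\<close> would be a third zero at horizontal distance 0,
    against \<open>far\<close>.\<close>
  have "of_real x \<notin> range lam"
  proof
    assume "of_real x \<in> range lam"
    then obtain i where i: "lam i = of_real x" by auto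
    have "i \<noteq> m" "i \<noteq> m'" using i m m' by (auto simp: complex_eq_iff)
    from far[OF this] show False using i c by simp
  qed
  hence a: "(\<Sum>i. 1 / (lam i - of_real x)\<^sup>2) \<in> \<real>\<^sub>\<ge>\<^sub>0" by (rule nonneg)
  have "(\<lambda>i. 1 / (lam i - of_real x)\<^sup>2) sums (\<Sum>i. 1 / (lam i - of_real x)\<^sup>2)"
    using summable_inverse_square_diff[OF nz sm] by (rule summable_sums)
  hence "(\<lambda>i. Re (1 / (lam i - of_real x)\<^sup>2)) sums Re (\<Sum>i. 1 / (lam i - of_real x)\<^sup>2)"
    by (rule sums_Re)
  hence lim: "(\<lambda>n. \<Sum>i<n. Re (1 / (lam i - of_real x)\<^sup>2)) 
      \<longlonglongrightarrow> Re (\<Sum>i. 1 / (lam i - of_real x)\<^sup>2)"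
    by (simp add: sums_def)
  have "Re (\<Sum>i. 1 / (lam i - of_real x)\<^sup>2) \<le> 2 * pi\<^sup>2 / (3 * c\<^sup>2) - 2 / \<beta>\<^sup>2"
  proof (rule LIMSEQ_le_const2[OF lim], intro exI allI impI)
    \<comment> \<open>Only partial sums that already contain both \<open>m\<close> and
      \<open>m'\<close> are bounded.\<close>
    fix n assume n: "max (Suc m) (Suc m') \<le> n"
    let ?I = "{..<n} - {m, m'}"
    have "(\<Sum>i<n. Re (1 / (lam i - of_real x)\<^sup>2))
        = (\<Sum>i\<in>?I. Re (1 / (lam i - of_real x)\<^sup>2)) + (\<Sum>i\<in>{m, m'}. Re (1 / (lam i - of_real x)\<^sup>2))"
      using n by (intro sum.subset_diff) auto
    also have "(\<Sum>i\<in>{m, m'}. Re (1 / (lam i - of_real x)\<^sup>2)) = - 2 / \<beta>\<^sup>2"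
    proof -
      have "lam m - of_real x = \<i> * of_real \<beta>" "lam m' - of_real x = - (\<i> * of_real \<beta>)"
        using m' by (auto simp: complex_eq_iff x_def \<beta>_def)
      hence "(lam m - of_real x)\<^sup>2 = of_real (- \<beta>\<^sup>2)" "(lam m' - of_real x)\<^sup>2 = of_real (- \<beta>\<^sup>2)"
        by (simp_all add: power_mult_distrib)
      hence "Re (1 / (lam m - of_real x)\<^sup>2) = - 1 / \<beta>\<^sup>2" "Re (1 / (lam m' - of_real x)\<^sup>2) = - 1 / \<beta>\<^sup>2"
        by (simp_all add: Re_divide_of_real del: of_real_minus of_real_power)
      thus ?thesis using \<open>m' \<noteq> m\<close> by simp
    qed
    also have "(\<Sum>i\<in>?I. Re (1 / (lam i - of_real x)\<^sup>2)) \<le> (\<Sum>i\<in>?I. 1 / (Re (lam i) - x)\<^sup>2)"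
    proof (rule sum_mono)
      fix i assume "i \<in> ?I"
      hence "Re (lam i - of_real x) \<noteq> 0" using far[of i] c by auto
      from Re_inverse_square_le[OF this]
      show "Re (1 / (lam i - of_real x)\<^sup>2) \<le> 1 / (Re (lam i) - x)\<^sup>2" by simp
    qed
    also have "\<dots> \<le> 2 * pi\<^sup>2 / (3 * c\<^sup>2)"
      by (rule sum_inverse_squares_separated_le[OF c inj sep]) (auto simp: far)
    finally show "(\<Sum>i<n. Re (1 / (lam i - of_real x)\<^sup>2)) \<le> 2 * pi\<^sup>2 / (3 * c\<^sup>2) - 2 / \<beta>\<^sup>2"
      by simp
  qed
  moreover have "0 \<le> Re (\<Sum>i. 1 / (lam i - of_real x)\<^sup>2)"
    using a by (simp add: complex_nonneg_Reals_iff)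
  ultimately have "2 / \<beta>\<^sup>2 \<le> 2 * pi\<^sup>2 / (3 * c\<^sup>2)" by linarith
  hence "3 * c\<^sup>2 \<le> pi\<^sup>2 * \<beta>\<^sup>2" using c m by (simp add: \<beta>_def field_simps)
  hence "(sqrt 3 * c)\<^sup>2 \<le> (pi * \<bar>\<beta>\<bar>)\<^sup>2" by (simp add: power_mult_distrib)
  hence "sqrt 3 * c \<le> pi * \<bar>\<beta>\<bar>" by (rule power2_le_imp_le) simp
  thus ?thesis by (simp add: \<beta>_def field_simps)
qed

section \<open>Spacing constant and aperture\<close>

lemma spacing_constant_le:
  assumes "inj lam" "i \<noteq> j" "lam i \<noteq> cnj (lam j)"
  shows "spacing_constant lam \<le> \<bar>Re (lam i) - Re (lam j)\<bar>"
proof -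
  have "Inf {\<bar>Re (lam i - lam j)\<bar> | i j. i \<noteq> j \<and> lam i \<noteq> cnj (lam j)} \<le> \<bar>Re (lam i - lam j)\<bar>"
    using assms by (intro cInf_lower bdd_belowI[of _ 0]) auto
  thus ?thesis using assms(1) by (simp add: spacing_constant_def)
qed

text \<open>The real infimum needs a nonempty set: if all pairs were conjugate, \<open>lam 1\<close>
  and \<open>lam 2\<close> would both be the conjugate of \<open>lam 0\<close>.\<close>

lemma spacing_constant_nonneg: "0 \<le> spacing_constant lam"
proof (cases "inj lam")
  case True
  have "\<exists>i j. i \<noteq> j \<and> lam i \<noteq> cnj (lam j)"
  proof (rule ccontr)
    assume "\<not> ?thesis"
    hence h: "lam i = cnj (lam j)" if "i \<noteq> j" for i j using that by blast
    have "lam 1 = lam 2" using h[of 1 0] h[of 2 0] by simp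
    thus False using True by (auto dest: injD)
  qed
  hence "0 \<le> Inf {\<bar>Re (lam i - lam j)\<bar> | i j. i \<noteq> j \<and> lam i \<noteq> cnj (lam j)}"
    by (intro cInf_greatest) auto
  thus ?thesis using True by (simp add: spacing_constant_def)
qed (simp add: spacing_constant_def)

theorem theorem1p1:
  fixes f :: "complex \<Rightarrow> complex" and d1 d2 :: complex and lam :: "nat \<Rightarrow> complex"
  assumes "genus_one f d1 d2 lam"
    and "f 0 \<noteq> 0"
    and "laguerre_polya 1 d2 lam"
  shows "aperture lam \<ge> ereal (sqrt 3 / pi)"
proof (cases "spacing_constant lam = 0 \<or> height lam = \<infinity>")
  case True
  thus ?thesis by (simp add: aperture_def)
next
  case False
  define c where "c = spacing_constant lam"
  have c: "c > 0" using False spacing_constant_nonneg[of lam] by (simp add: c_def)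
  \<comment> \<open>A repeated zero would make the spacing constant 0.\<close>
  have inj: "inj lam" using False by (auto simp: spacing_constant_def split: if_splits)
  have "sqrt 3 / pi * c \<le> \<bar>Im (lam i)\<bar>" if "Im (lam i) \<noteq> 0" for i
  proof (rule abs_Im_ge_of_separated[OF _ _ _ c inj _ that])
    show "lam i \<noteq> 0" "summable (\<lambda>i. 1 / (cmod (lam i))\<^sup>2)" for i
      using assms(1) by (auto simp: genus_one_def)
    show "(\<Sum>i. 1 / (lam i - of_real x)\<^sup>2) \<in> \<real>\<^sub>\<ge>\<^sub>0" if "of_real x \<notin> range lam" for x
      using assms(3) that by (intro pos_semidef_LP_matrix_1) (auto simp: laguerre_polya_def)
    show "c \<le> \<bar>Re (lam i) - Re (lam j)\<bar>" if "i \<noteq> j" "lam i \<noteq> cnj (lam j)" for i j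
      unfolding c_def using inj that by (rule spacing_constant_le)
  qed
  hence "ereal (sqrt 3 / pi * c) \<le> height lam"
    unfolding height_def by (intro INF_greatest) simp
  hence "ereal (sqrt 3 / pi) * ereal c \<le> height lam" by simp
  hence "ereal (sqrt 3 / pi) \<le> height lam / ereal c"
    using c by (subst ereal_le_divide_pos) (auto simp: mult.commute)
  thus ?thesis using False by (simp add: aperture_def c_def)
qed

end
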